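(* Let $\mathcal{F}$ be a holomorphic codimension one foliation on $\mathbb{P}^2_{\mathbb{C}}$. There exists a birational self map $\phi$ from $\mathbb{P}^2_{\mathbb{C}}$ into itself such that the foliation $\phi^{-1}\mathcal{F}$ has at most one singular point.
   Context: Let $\pi\colon\mathbb{C}^3\smallsetminus\{0\}\to\mathbb{P}^2_{\mathbb{C}}$ be the canonical projection. A holomorphic codimension one (possibly singular) foliation $\mathcal{F}$ of degree $d\geq 0$ on $\mathbb{P}^2_{\mathbb{C}}$ is given by a $1$-form $\omega=a\,\mathrm{d}x+b\,\mathrm{d}y+c\,\mathrm{d}z$ on $\mathbb{C}^3$, unique up to a nonzero constant factor, where $a,b,c\in\mathbb{C}[x,y,z]$ are homogeneous polynomials of degree $d+1$ without common component (that is, with no nonconstant common factor) satisfying the Euler identity $ax+by+cz=0$. Its singular set is $\mathrm{Sing}(\mathcal{F})=\pi(\{a=b=c=0\}\smallsetminus\{0\})$, and a singular point of $\mathcal{F}$ is an element of this set. For a birational self map $\phi$ of $\mathbb{P}^2_{\mathbb{C}}$, given in homogeneous coordinates by three homogeneous polynomials of the same degree without common factor, $\phi^{-1}\mathcal{F}$ denotes the pulled-back foliation, namely the foliation on $\mathbb{P}^2_{\mathbb{C}}$ defined by the $1$-form obtained from $\phi^*\omega$ (pull-back by the homogeneous polynomial lift of $\phi$) by dividing out the greatest common divisor of its coefficients. *)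

theory Defs
  imports "HOL-Analysis.Cartesian_Space" "HOL-Computational_Algebra.Polynomial_Factorial"
    "HOL-Computational_Algebra.Field_as_Ring"
begin

text \<open>
  The ring \<open>\<complex>[x,y,z]\<close> is taken as \<open>\<complex>[x][y][z]\<close>: the outermost polynomial variable is \<open>z\<close>,
  the innermost one is \<open>x\<close>. In this representation the library supplies the factorial ring
  structure and \<^const>\<open>gcd\<close>. Triples of polynomials are vectors indexed by the type \<open>3\<close>.
\<close>

type_synonym poly3 = "complex poly poly poly"

definition const3 :: "complex \<Rightarrow> poly3" where
  "const3 c = [:[:[:c:]:]:]"

definition vars :: "poly3 ^ 3" where
  "vars = vector [[:[:[:0, 1:]:]:], [:[:0, 1:]:], [:0, 1:]]"

definition homogeneous :: "nat \<Rightarrow> poly3 \<Rightarrow> bool" where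
  "homogeneous n p \<longleftrightarrow> (\<forall>i j k. coeff (coeff (coeff p k) j) i \<noteq> 0 \<longrightarrow> i + j + k = n)"

definition partial :: "3 \<Rightarrow> poly3 \<Rightarrow> poly3" where
  "partial i = (if i = 1 then map_poly (map_poly pderiv)
                else if i = 2 then map_poly pderiv else pderiv)"

text \<open>
  \<open>insert3 h v p\<close> is \<open>p(v\<^sub>1, v\<^sub>2, v\<^sub>3)\<close> in a ring receiving the coefficients through \<open>h\<close>.
\<close>

definition insert3 :: "(complex \<Rightarrow> 'a::comm_ring_1) \<Rightarrow> 'a ^ 3 \<Rightarrow> poly3 \<Rightarrow> 'a" where
  "insert3 h v p =
     poly (map_poly (\<lambda>q. poly (map_poly (\<lambda>s. poly (map_poly h s) (v $ 1)) q) (v $ 2)) p) (v $ 3)"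

definition eval3 :: "poly3 \<Rightarrow> complex ^ 3 \<Rightarrow> complex" where
  "eval3 p v = insert3 (\<lambda>c. c) v p"

definition compose3 :: "poly3 \<Rightarrow> poly3 ^ 3 \<Rightarrow> poly3" where
  "compose3 p \<phi> = insert3 const3 \<phi> p"

definition no_common_factor :: "poly3 ^ 3 \<Rightarrow> bool" where
  "no_common_factor v \<longleftrightarrow> (\<forall>g. (\<forall>i. g dvd v $ i) \<longrightarrow> (\<exists>c. g = const3 c))"

text \<open>The point of the projective plane with homogeneous coordinates \<open>v \<noteq> 0\<close>.\<close>

definition proj :: "complex ^ 3 \<Rightarrow> (complex ^ 3) set" where
  "proj v = {c *s v | c. c \<noteq> 0}"

text \<open>
  The vector \<open>(a, b, c)\<close> stands for the 1-form \<open>a dx + b dy + c dz\<close>. A foliation is the class of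
  its defining forms, which are determined up to a nonzero constant.
\<close>

definition foliation_form :: "nat \<Rightarrow> poly3 ^ 3 \<Rightarrow> bool" where
  "foliation_form d \<omega> \<longleftrightarrow> (\<forall>i. homogeneous (d + 1) (\<omega> $ i)) \<and> no_common_factor \<omega> \<and>
     (\<Sum>i\<in>UNIV. \<omega> $ i * vars $ i) = 0"

definition form_class :: "poly3 ^ 3 \<Rightarrow> (poly3 ^ 3) set" where
  "form_class \<omega> = {const3 c *s \<omega> | c. c \<noteq> 0}"

definition foliation :: "nat \<Rightarrow> (poly3 ^ 3) set \<Rightarrow> bool" where
  "foliation d \<F> \<longleftrightarrow> (\<exists>\<omega>. foliation_form d \<omega> \<and> \<F> = form_class \<omega>)"

definition Sing :: "(poly3 ^ 3) set \<Rightarrow> (complex ^ 3) set set" where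
  "Sing \<F> = proj ` {v. v \<noteq> 0 \<and> (\<forall>\<omega>\<in>\<F>. \<forall>i. eval3 (\<omega> $ i) v = 0)}"

text \<open>
  Rational self maps of the plane are given by their homogeneous coordinates. For a birational map,
  both composites with the inverse are the identity, up to the common factors \<open>r\<close> and \<open>s\<close>.
\<close>

definition rational_map :: "poly3 ^ 3 \<Rightarrow> bool" where
  "rational_map \<phi> \<longleftrightarrow> (\<exists>n. \<forall>i. homogeneous n (\<phi> $ i)) \<and> no_common_factor \<phi>"

definition birational :: "poly3 ^ 3 \<Rightarrow> bool" where
  "birational \<phi> \<longleftrightarrow> rational_map \<phi> \<and>
     (\<exists>\<psi> r s. rational_map \<psi> \<and> r \<noteq> 0 \<and> s \<noteq> 0 \<and>
        (\<chi> i. compose3 (\<phi> $ i) \<psi>) = r *s vars \<and>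
        (\<chi> i. compose3 (\<psi> $ i) \<phi>) = s *s vars)"

definition pullback_form :: "poly3 ^ 3 \<Rightarrow> poly3 ^ 3 \<Rightarrow> poly3 ^ 3" where
  "pullback_form \<phi> \<omega> = (\<chi> j. \<Sum>i\<in>UNIV. compose3 (\<omega> $ i) \<phi> * partial j (\<phi> $ i))"

definition reduce_form :: "poly3 ^ 3 \<Rightarrow> poly3 ^ 3" where
  "reduce_form \<omega> = (\<chi> i. \<omega> $ i div gcd (gcd (\<omega> $ 1) (\<omega> $ 2)) (\<omega> $ 3))"

text \<open>
  The library's \<^const>\<open>gcd\<close> is normalized, hence unchanged when a form is multiplied by a nonzero
  constant; so the image of the class of \<open>\<omega>\<close> is again a full class of proportional forms.
\<close>

definition pullback :: "poly3 ^ 3 \<Rightarrow> (poly3 ^ 3) set \<Rightarrow> (poly3 ^ 3) set" where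
  "pullback \<phi> \<F> = (\<lambda>\<omega>. reduce_form (pullback_form \<phi> \<omega>)) ` \<F>"

end

theory Submission
  imports Defs "HOL-Analysis.Determinants"
begin

text \<open>
  Write \<open>\<omega> = a dx + b dy + c dz\<close> and consider the pencil of lines \<open>y = s x\<close> through \<open>(0 : 0 : 1)\<close>; in the
  chart \<open>x = 1\<close> they are the fibres of \<open>(y, z) \<mapsto> y\<close>. The foliation has finitely many singular points in
  the chart, so they lie on finitely many fibres, and a map contracting these fibres to regular
  points of the foliation makes the pull-back regular on the whole chart. Such a map is
  \<open>(y, z) \<mapsto> (y, h(y)\<^sup>2 z + h(y)\<^sup>4 + t)\<close>, where the roots of \<open>h\<close> are the slopes of these fibres. It is birational,
  being affine in \<open>z\<close>. On a contracted fibre its derivative has rank one and the pull-back is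
  \<open>b(1, s, t) dy\<close>, which is nonzero for a generic constant \<open>t\<close> (\<open>regular_in_chart\<close>).

  What remains is the line at infinity \<open>x = 0\<close>. Because \<open>h\<^sup>4\<close> dominates in degree, this line is mapped to
  the point \<open>(0 : 0 : 1)\<close>. A preliminary linear change of coordinates (\<open>generic_frame\<close>) makes this point
  regular with \<open>b(0, 0, 1) \<noteq> 0\<close>. Then, after removal of the power of \<open>x\<close> that the pull-back contains, the
  coefficient of \<open>dx\<close> restricted to \<open>x = 0\<close> is a nonzero constant times a power of \<open>y\<close>
  (\<open>zeros_of_reduced_pullback\<close>). So \<open>(0 : 0 : 1)\<close> is the only possible singular point.

  That the singular points lie on finitely many fibres is elimination theory: by the Euler identity
  and \<open>b(0, 0, 1) \<noteq> 0\<close> the polynomials \<open>b\<close> and \<open>c\<close> are coprime, and an ideal generated by two coprime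
  polynomials contains a nonzero polynomial in \<open>x\<close> and \<open>y\<close> alone (\<open>ideal_meets_constants\<close>,
  \<open>finite_singular_slopes\<close>).
\<close>

section \<open>Homomorphisms out of iterated polynomial rings\<close>

definition unital_hom :: "('a::comm_ring_1 \<Rightarrow> 'b::comm_ring_1) \<Rightarrow> bool" where
  "unital_hom h \<longleftrightarrow> h 1 = 1 \<and> (\<forall>x y. h (x + y) = h x + h y) \<and> (\<forall>x y. h (x * y) = h x * h y)"

context
  fixes h :: "'a::comm_ring_1 \<Rightarrow> 'b::comm_ring_1"
  assumes h: "unital_hom h"
begin

lemma unital_hom_one: "h 1 = 1"
  and unital_hom_add: "h (x + y) = h x + h y"
  and unital_hom_mult: "h (x * y) = h x * h y"
  using h by (auto simp: unital_hom_def)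

lemma unital_hom_zero: "h 0 = 0"
  using unital_hom_add[of 0 0] by simp

lemma unital_hom_diff: "h (x - y) = h x - h y"
  using unital_hom_add[of "x - y" y] by (simp add: algebra_simps)

lemma unital_hom_power: "h (x ^ n) = h x ^ n"
  by (induction n) (simp_all add: unital_hom_one unital_hom_mult)

lemma unital_hom_of_nat: "h (of_nat n) = of_nat n"
  by (induction n) (simp_all add: unital_hom_zero unital_hom_one unital_hom_add)

lemma unital_hom_sum: "h (sum f A) = (\<Sum>x\<in>A. h (f x))"
  by (induction A rule: infinite_finite_induct) (simp_all add: unital_hom_zero unital_hom_add)

lemma unital_hom_prod: "h (prod f A) = (\<Prod>x\<in>A. h (f x))"
  by (induction A rule: infinite_finite_induct) (simp_all add: unital_hom_one unital_hom_mult)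

lemma unital_hom_poly_map_poly: "unital_hom (\<lambda>p. poly (map_poly h p) x)"
proof -
  have add: "poly (map_poly h (p + q)) x = poly (map_poly h p) x + poly (map_poly h q) x" for p q
  proof -
    have "map_poly h (p + q) = map_poly h p + map_poly h q"
      by (rule poly_eqI) (simp add: coeff_map_poly unital_hom_zero unital_hom_add)
    then show ?thesis by simp
  qed
  have smult: "poly (map_poly h (smult c q)) x = h c * poly (map_poly h q) x" for c q
    by (simp add: map_poly_smult unital_hom_zero unital_hom_mult)
  have "poly (map_poly h (p * q)) x = poly (map_poly h p) x * poly (map_poly h q) x" for p q
    by (induction p)
      (simp_all add: map_poly_pCons unital_hom_zero add smult algebra_simps)
  then show ?thesis
    by (simp add: unital_hom_def add unital_hom_one)
qed

end

text \<open>
  A polynomial ring is generated by its constants and its variable, so a homomorphism out of it is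
  the evaluation that its values on these dictate. Applied once per variable, this will identify
  any composite of substitutions without computing with nested coefficients.
\<close>

lemma unital_hom_poly_unique:
  assumes "unital_hom T"
  shows "T p = poly (map_poly (\<lambda>a. T [:a:]) p) (T [:0, 1:])"
proof (induction p)
  case 0
  then show ?case by (simp add: unital_hom_zero[OF assms])
next
  case (pCons a p)
  have "pCons a p = [:a:] + [:0, 1:] * p" by simp
  then have "T (pCons a p) = T [:a:] + T [:0, 1:] * T p"
    by (metis unital_hom_add[OF assms] unital_hom_mult[OF assms])
  then show ?case
    by (simp add: map_poly_pCons unital_hom_zero[OF assms] pCons.IH)
qed

lemma unital_hom_const: "unital_hom (\<lambda>a. [:a:])"
  by (simp add: unital_hom_def one_pCons)

lemma unital_hom_comp: "unital_hom f \<Longrightarrow> unital_hom g \<Longrightarrow> unital_hom (\<lambda>x. f (g x))"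
  by (simp add: unital_hom_def)

lemma vars_simps:
  "vars $ 1 = [:[:[:0, 1:]:]:]" "vars $ 2 = [:[:0, 1:]:]" "vars $ 3 = [:0, 1:]"
  by (simp_all add: vars_def)

lemma unital_hom_insert3: "unital_hom h \<Longrightarrow> unital_hom (insert3 h v)"
  unfolding insert3_def by (intro unital_hom_poly_map_poly)

lemma insert3_const3: "unital_hom h \<Longrightarrow> insert3 h v (const3 c) = h c"
  by (simp add: insert3_def const3_def map_poly_pCons unital_hom_zero)

lemma insert3_vars:
  assumes "unital_hom h"
  shows "insert3 h v (vars $ i) = v $ i"
  using exhaust_3[of i]
  by (auto simp: insert3_def vars_simps map_poly_pCons unital_hom_zero[OF assms] unital_hom_one[OF assms])

lemma unital_hom_unique:
  assumes "unital_hom T" "\<And>c. T (const3 c) = h c" "\<And>i. T (vars $ i) = v $ i"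
  shows "T p = insert3 h v p"
proof -
  have 1: "unital_hom (\<lambda>q. T [:q:])"
    using unital_hom_comp[OF assms(1) unital_hom_const] .
  have 2: "unital_hom (\<lambda>q. T [:[:q:]:])"
    using unital_hom_comp[OF 1 unital_hom_const] .
  have h: "(\<lambda>c. T [:[:[:c:]:]:]) = h"
    using assms(2) by (simp add: const3_def)
  have "T [:[:s:]:] = poly (map_poly h s) (v $ 1)" for s
    using unital_hom_poly_unique[OF 2, of s] assms(3)[of 1] by (simp add: h vars_simps)
  then have "T [:q:] = poly (map_poly (\<lambda>s. poly (map_poly h s) (v $ 1)) q) (v $ 2)" for q
    using unital_hom_poly_unique[OF 1, of q] assms(3)[of 2] by (simp add: vars_simps)
  then show ?thesis
    using unital_hom_poly_unique[OF assms(1), of p] assms(3)[of 3]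
    by (simp add: vars_simps insert3_def)
qed

lemma poly_map_poly_altdef:
  fixes f :: "'a::zero \<Rightarrow> 'b::comm_semiring_1"
  assumes "f 0 = 0"
  shows "poly (map_poly f p) x = (\<Sum>k\<le>degree p. f (coeff p k) * x ^ k)"
proof -
  have "poly (map_poly f p) x = (\<Sum>k\<le>degree (map_poly f p). f (coeff p k) * x ^ k)"
    by (simp add: poly_altdef coeff_map_poly assms)
  also have "\<dots> = (\<Sum>k\<le>degree p. f (coeff p k) * x ^ k)"
  proof (rule sum.mono_neutral_left)
    show "{..degree (map_poly f p)} \<subseteq> {..degree p}"
      using map_poly_degree_leq[of f p] by auto
    show "\<forall>k\<in>{..degree p} - {..degree (map_poly f p)}. f (coeff p k) * x ^ k = 0"
    proof
      fix k assume "k \<in> {..degree p} - {..degree (map_poly f p)}"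
      then have "coeff (map_poly f p) k = 0" by (intro coeff_eq_0) auto
      then show "f (coeff p k) * x ^ k = 0" by (simp add: coeff_map_poly assms)
    qed
  qed simp
  finally show ?thesis .
qed

text \<open>
  The monomial expansion, through which the coefficientwise notion of homogeneity reaches
  substitutions and values.
\<close>

lemma insert3_altdef:
  assumes "unital_hom h"
  shows "insert3 h v p = (\<Sum>k\<le>degree p. \<Sum>j\<le>degree (coeff p k). \<Sum>i\<le>degree (coeff (coeff p k) j).
    h (coeff (coeff (coeff p k) j) i) * v $ 1 ^ i * v $ 2 ^ j * v $ 3 ^ k)"
  unfolding insert3_def
  by (simp add: poly_map_poly_altdef unital_hom_zero[OF assms] sum_distrib_right)

section \<open>Evaluation and composition of ternary polynomials\<close>

lemma unital_hom_id: "unital_hom (\<lambda>c. c)"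
  by (simp add: unital_hom_def)

lemma unital_hom_const3: "unital_hom const3"
  by (simp add: unital_hom_def const3_def one_pCons)

lemma unital_hom_eval3: "unital_hom (\<lambda>p. eval3 p v)"
  unfolding eval3_def by (intro unital_hom_insert3 unital_hom_id)

lemma unital_hom_compose3: "unital_hom (\<lambda>p. compose3 p \<phi>)"
  unfolding compose3_def by (intro unital_hom_insert3 unital_hom_const3)

lemmas const3_hom [simp] =
  unital_hom_one[OF unital_hom_const3] unital_hom_zero[OF unital_hom_const3]
lemmas eval3_hom [simp] =
  unital_hom_one[OF unital_hom_eval3] unital_hom_zero[OF unital_hom_eval3]
  unital_hom_add[OF unital_hom_eval3] unital_hom_mult[OF unital_hom_eval3]
  unital_hom_diff[OF unital_hom_eval3] unital_hom_power[OF unital_hom_eval3]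
  unital_hom_of_nat[OF unital_hom_eval3] unital_hom_sum[OF unital_hom_eval3] unital_hom_prod[OF unital_hom_eval3]
lemmas compose3_hom [simp] =
  unital_hom_one[OF unital_hom_compose3] unital_hom_zero[OF unital_hom_compose3]
  unital_hom_add[OF unital_hom_compose3] unital_hom_mult[OF unital_hom_compose3]
  unital_hom_diff[OF unital_hom_compose3] unital_hom_power[OF unital_hom_compose3]
  unital_hom_of_nat[OF unital_hom_compose3] unital_hom_sum[OF unital_hom_compose3] unital_hom_prod[OF unital_hom_compose3]

lemma eval3_const3 [simp]: "eval3 (const3 c) v = c"
  by (simp add: eval3_def insert3_const3 unital_hom_id)

lemma eval3_vars [simp]: "eval3 (vars $ i) v = v $ i"
  by (simp add: eval3_def insert3_vars unital_hom_id)

lemma compose3_const3 [simp]: "compose3 (const3 c) \<phi> = const3 c"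
  by (simp add: compose3_def insert3_const3 unital_hom_const3)

lemma compose3_vars [simp]: "compose3 (vars $ i) \<phi> = \<phi> $ i"
  by (simp add: compose3_def insert3_vars unital_hom_const3)

lemma eval3_compose3 [simp]: "eval3 (compose3 p \<phi>) v = eval3 p (\<chi> i. eval3 (\<phi> $ i) v)"
  unfolding eval3_def[of p]
  by (rule unital_hom_unique[OF unital_hom_comp[OF unital_hom_eval3 unital_hom_compose3]]) simp_all

lemma compose3_dvd: "p dvd q \<Longrightarrow> compose3 p \<phi> dvd compose3 q \<phi>"
  by (auto elim!: dvdE)

text \<open>
  \<open>\<complex>\<close> is infinite: the variables \<open>z\<close>, \<open>y\<close>, \<open>x\<close> can be stripped off one after the other.
\<close>

lemma eval3_eq_0_imp:
  assumes "\<And>v. eval3 p v = 0"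
  shows "p = 0"
proof -
  have e: "poly (map_poly (\<lambda>q. poly (map_poly (\<lambda>s. poly s x) q) y) p) z = 0" for x y z
    using assms[of "vector [x, y, z]"] by (simp add: eval3_def insert3_def)
  then have "map_poly (\<lambda>q. poly (map_poly (\<lambda>s. poly s x) q) y) p = 0" for x y
    by (intro poly_all_0_iff_0[THEN iffD1] allI)
  from this[THEN arg_cong, of "\<lambda>r. coeff r k" for k]
  have "poly (map_poly (\<lambda>s. poly s x) (coeff p k)) y = 0" for x y k
    by (simp add: coeff_map_poly)
  then have "map_poly (\<lambda>s. poly s x) (coeff p k) = 0" for x k
    by (intro poly_all_0_iff_0[THEN iffD1] allI)
  from this[THEN arg_cong, of "\<lambda>r. coeff r j" for j]
  have "poly (coeff (coeff p k) j) x = 0" for x k j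
    by (simp add: coeff_map_poly)
  then have "coeff (coeff p k) j = 0" for k j
    by (intro poly_all_0_iff_0[THEN iffD1] allI)
  then show ?thesis by (intro poly_eqI) simp
qed

lemma eval3_eqI:
  assumes "\<And>v. eval3 p v = eval3 q v"
  shows "p = q"
  using eval3_eq_0_imp[of "p - q"] assms by simp

lemma compose3_compose3: "compose3 (compose3 p \<phi>) \<psi> = compose3 p (\<chi> i. compose3 (\<phi> $ i) \<psi>)"
  by (rule eval3_eqI) simp

lemma compose3_id [simp]: "compose3 p vars = p"
  by (rule eval3_eqI) simp

section \<open>Homogeneous polynomials\<close>

lemma homogeneous_const: "homogeneous 0 (const3 c)"
  by (auto simp: homogeneous_def const3_def coeff_pCons split: nat.splits)

lemma homogeneous_vars: "homogeneous 1 (vars $ i)"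
  using exhaust_3[of i]
  by (auto simp: homogeneous_def vars_simps coeff_pCons one_pCons split: nat.splits)

lemma homogeneous_0: "homogeneous n 0"
  by (simp add: homogeneous_def)

lemma homogeneous_add: "homogeneous n p \<Longrightarrow> homogeneous n q \<Longrightarrow> homogeneous n (p + q)"
  unfolding homogeneous_def coeff_add by (metis add_0)

lemma homogeneous_diff: "homogeneous n p \<Longrightarrow> homogeneous n q \<Longrightarrow> homogeneous n (p - q)"
  unfolding homogeneous_def coeff_diff by (metis diff_zero)

lemma homogeneous_sum: "(\<And>x. x \<in> A \<Longrightarrow> homogeneous n (f x)) \<Longrightarrow> homogeneous n (sum f A)"
  by (induction A rule: infinite_finite_induct) (simp_all add: homogeneous_0 homogeneous_add)

lemma homogeneous_mult:
  assumes "homogeneous m p" "homogeneous n q" "N = m + n"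
  shows "homogeneous N (p * q)"
  unfolding homogeneous_def
proof (intro allI impI)
  fix i j k
  assume "coeff (coeff (coeff (p * q) k) j) i \<noteq> 0"
  then obtain k' where "k' \<le> k" "coeff (coeff (coeff p k' * coeff q (k - k')) j) i \<noteq> 0"
    by (auto simp: coeff_mult[of p q] coeff_sum elim!: sum.not_neutral_contains_not_neutral)
  moreover from this obtain j' where
    "j' \<le> j" "coeff (coeff (coeff p k') j' * coeff (coeff q (k - k')) (j - j')) i \<noteq> 0"
    by (auto simp: coeff_mult[of "coeff p k'"] coeff_sum elim!: sum.not_neutral_contains_not_neutral)
  moreover from this obtain i' where "i' \<le> i"
    "coeff (coeff (coeff p k') j') i' * coeff (coeff (coeff q (k - k')) (j - j')) (i - i') \<noteq> 0"
    by (auto simp: coeff_mult[of "coeff (coeff p k') j'"] elim!: sum.not_neutral_contains_not_neutral)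
  moreover from this have "coeff (coeff (coeff p k') j') i' \<noteq> 0"
    "coeff (coeff (coeff q (k - k')) (j - j')) (i - i') \<noteq> 0"
    by simp_all
  then have "i' + j' + k' = m" "(i - i') + (j - j') + (k - k') = n"
    using assms(1,2) unfolding homogeneous_def by blast+
  ultimately show "i + j + k = N" using assms(3) by linarith
qed

lemma homogeneous_power: "homogeneous m p \<Longrightarrow> N = m * n \<Longrightarrow> homogeneous N (p ^ n)"
proof (induction n arbitrary: N)
  case 0
  then show ?case using homogeneous_const[of 1] by simp
next
  case (Suc n)
  then show ?case using homogeneous_mult[OF Suc.prems(1) Suc.IH[OF _ refl]] by simp
qed

lemma homogeneous_prod:
  "(\<And>x. x \<in> A \<Longrightarrow> homogeneous 1 (f x)) \<Longrightarrow> homogeneous (card A) (prod f A)"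
proof (induction A rule: infinite_finite_induct)
  case (insert x A)
  then show ?case using homogeneous_mult[of 1 "f x" "card A" "prod f A"] by simp
qed (use homogeneous_const[of 1] in simp_all)

lemma homogeneous_compose3:
  assumes "homogeneous n p" "\<And>i. homogeneous m (\<phi> $ i)"
  shows "homogeneous (m * n) (compose3 p \<phi>)"
proof -
  have "homogeneous (m * n) (const3 (coeff (coeff (coeff p k) j) i) * \<phi> $ 1 ^ i * \<phi> $ 2 ^ j * \<phi> $ 3 ^ k)"
    for i j k
  proof (cases "coeff (coeff (coeff p k) j) i = 0")
    case False
    then have n: "n = i + j + k" using assms(1) by (auto simp: homogeneous_def)
    have pow: "homogeneous (m * l) (\<phi> $ a ^ l)" for a l
      by (rule homogeneous_power[OF assms(2) refl])
    show ?thesis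
      unfolding n distrib_left
      by (rule homogeneous_mult[OF homogeneous_mult[OF homogeneous_mult[OF homogeneous_const pow refl] pow refl] pow])
        simp_all
  qed (simp add: homogeneous_0)
  then show ?thesis
    unfolding compose3_def insert3_altdef[OF unital_hom_const3] by (intro homogeneous_sum)
qed

lemma eval3_homogeneous:
  assumes "homogeneous n p"
  shows "eval3 p (c *s v) = c ^ n * eval3 p v"
proof -
  have *: "a * (c *s v) $ 1 ^ i * (c *s v) $ 2 ^ j * (c *s v) $ 3 ^ k =
      c ^ n * (a * v $ 1 ^ i * v $ 2 ^ j * v $ 3 ^ k)"
    if "a = coeff (coeff (coeff p k) j) i" for i j k a
  proof (cases "a = 0")
    case False
    then have "n = i + j + k" using assms(1) that by (auto simp: homogeneous_def)
    then show ?thesis by (simp add: power_mult_distrib power_add)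
  qed simp
  then show ?thesis
    unfolding eval3_def insert3_altdef[OF unital_hom_id] sum_distrib_left
    by (intro sum.cong refl *)
qed

section \<open>Partial derivatives\<close>

text \<open>
  \<^const>\<open>partial\<close> differentiates in one of three nested layers of coefficients. The Leibniz rule passes
  from a coefficient ring to the polynomials over it, which treats the three cases alike.
\<close>

definition derivation :: "('a::comm_ring_1 \<Rightarrow> 'a) \<Rightarrow> bool" where
  "derivation D \<longleftrightarrow> (\<forall>p q. D (p + q) = D p + D q) \<and> (\<forall>p q. D (p * q) = D p * q + p * D q)"

lemma derivation_0: "derivation D \<Longrightarrow> D 0 = 0"
  unfolding derivation_def by (metis add_cancel_left_left add_0)

lemma derivation_pderiv: "derivation (pderiv :: 'a::idom poly \<Rightarrow> _)"
  by (simp add: derivation_def pderiv_add pderiv_mult algebra_simps)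

lemma derivation_map_poly:
  assumes "derivation D"
  shows "derivation (map_poly D)"
proof -
  note D0 = derivation_0[OF assms]
  have add: "map_poly D (p + q) = map_poly D p + map_poly D q" for p q
    using assms by (intro poly_eqI) (simp add: coeff_map_poly D0 derivation_def)
  have smult: "map_poly D (smult c q) = smult (D c) q + smult c (map_poly D q)" for c q
    using assms by (intro poly_eqI) (simp add: coeff_map_poly D0 derivation_def)
  have "map_poly D (p * q) = map_poly D p * q + p * map_poly D q" for p q
    by (induction p) (simp_all add: map_poly_pCons D0 add smult algebra_simps)
  then show ?thesis using add by (simp add: derivation_def)
qed

lemma derivation_partial: "derivation (partial i)"
  by (simp add: partial_def derivation_map_poly derivation_pderiv)

lemma partial_add [simp]: "partial i (p + q) = partial i p + partial i q"
  and partial_mult [simp]: "partial i (p * q) = partial i p * q + p * partial i q"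
  using derivation_partial[of i] by (auto simp: derivation_def)

lemma partial_diff [simp]: "partial i (p - q) = partial i p - partial i q"
  using partial_add[of i "p - q" q] by (simp del: partial_add)

lemma partial_const3 [simp]: "partial i (const3 c) = 0"
  by (simp add: partial_def const3_def map_poly_pCons)

lemma partial_vars: "partial i (vars $ j) = (if i = j then 1 else 0)"
  using exhaust_3[of i] exhaust_3[of j]
  by (auto simp: partial_def vars_simps map_poly_pCons pderiv_pCons one_pCons)

lemma partial_0 [simp]: "partial i 0 = 0"
  using partial_const3[of i 0] by simp

lemma partial_1 [simp]: "partial i 1 = 0"
  using partial_const3[of i 1] by simp

lemma partial_sum: "partial i (sum f A) = (\<Sum>x\<in>A. partial i (f x))"
  by (induction A rule: infinite_finite_induct) simp_all

lemma partial_power: "partial i (p ^ n) = of_nat n * p ^ (n - 1) * partial i p"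
proof (induction n)
  case (Suc n)
  show ?case
  proof (cases n)
    case (Suc m)
    show ?thesis unfolding power_Suc partial_mult Suc.IH
      by (simp add: Suc algebra_simps)
  qed simp
qed simp

section \<open>Elimination\<close>

text \<open>
  Elimination of the outer variable, in place of a resultant. In the ideal generated by \<open>p\<close> and \<open>q\<close>
  take a nonzero \<open>g\<close> of least degree. Pseudo-division of \<open>f\<close> in the ideal by \<open>g\<close> leaves a remainder of the
  ideal, hence zero, so \<open>g\<close> divides a constant multiple of \<open>f\<close>, and by Gauss's lemma the primitive part
  of \<open>g\<close> divides \<open>f\<close> itself. Being a common factor of \<open>p\<close> and \<open>q\<close> it is a unit, and \<open>g\<close> is a constant.
\<close>

lemma ideal_meets_constants:
  fixes p q :: "'a::{factorial_semiring,semiring_Gcd,ring_gcd,idom_divide,semiring_gcd_mult_normalize} poly"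
  assumes "coprime p q" "p \<noteq> 0"
  obtains u v r where "r \<noteq> 0" "u * p + v * q = [:r:]"
proof -
  define I where "I = {g. \<exists>u v. g = u * p + v * q}"
  have "p = 1 * p + 0 * q" "q = 0 * p + 1 * q" by simp_all
  then have pq: "p \<in> I" "q \<in> I" unfolding I_def by blast+
  have I_sub: "smult c f - g * a \<in> I" if "f \<in> I" "g \<in> I" for f g a c
  proof -
    obtain u v u' v' where "f = u * p + v * q" "g = u' * p + v' * q"
      using \<open>f \<in> I\<close> \<open>g \<in> I\<close> by (auto simp: I_def)
    then have "smult c f - g * a = (smult c u - u' * a) * p + (smult c v - v' * a) * q"
      by (simp add: algebra_simps smult_add_right)
    then show ?thesis unfolding I_def by blast
  qed
  obtain g where g: "g \<in> I" "g \<noteq> 0" "\<And>f. f \<in> I \<Longrightarrow> f \<noteq> 0 \<Longrightarrow> degree g \<le> degree f"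
    using ex_has_least_nat[of "\<lambda>g. g \<in> I \<and> g \<noteq> 0" p degree] pq assms by blast
  have dvd: "primitive_part g dvd f" if f: "f \<in> I" for f
  proof -
    obtain a b where ab: "pseudo_divmod f g = (a, b)" by fastforce
    define c where "c = lead_coeff g ^ (Suc (degree f) - degree g)"
    have c: "c \<noteq> 0" using g(2) by (simp add: c_def)
    have eq: "smult c f = g * a + b" and deg: "b = 0 \<or> degree b < degree g"
      using pseudo_divmod[OF g(2) ab] by (simp_all add: c_def)
    have "b \<in> I" using I_sub[OF f g(1), of c a] by (simp add: eq)
    then have "b = 0" using g(3)[of b] deg by force
    then have "g dvd smult c f" using eq by simp
    moreover have "primitive_part g dvd g"
      by (metis content_times_primitive_part dvd_smult dvd_refl)
    ultimately have "fract_poly (primitive_part g) dvd smult (to_fract c) (fract_poly f)"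
      by (metis dvd_trans fract_poly_dvd fract_poly_smult)
    then have "fract_poly (primitive_part g) dvd fract_poly f"
      using c by (simp add: dvd_smult_iff)
    then show ?thesis using g(2) by (intro fract_poly_dvdD) simp_all
  qed
  have "is_unit (primitive_part g)"
    using assms(1) dvd pq by (meson coprime_common_divisor)
  then have "degree g = 0"
    by (metis is_unit_poly_iff degree_primitive_part degree_pCons_0)
  then obtain r where "g = [:r:]" by (auto elim: degree_eq_zeroE)
  then show ?thesis using that[of r] g(1,2) by (auto simp: I_def)
qed

section \<open>Linear changes of coordinates\<close>

definition lin :: "complex ^ 3 ^ 3 \<Rightarrow> poly3 ^ 3" where
  "lin L = (\<chi> i. \<Sum>j\<in>UNIV. const3 (L $ i $ j) * vars $ j)"

lemma compose3_lin: "compose3 (lin L $ i) \<phi> = (\<Sum>j\<in>UNIV. const3 (L $ i $ j) * \<phi> $ j)"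
  by (simp add: lin_def)

lemma lin_comp:
  assumes "L ** M = mat 1"
  shows "(\<chi> i. compose3 (lin L $ i) (lin M)) = vars"
proof (intro vec_eq_iff[THEN iffD2] allI, rule eval3_eqI)
  fix i v
  have "eval3 ((\<chi> i. compose3 (lin L $ i) (lin M)) $ i) v = (L *v (M *v v)) $ i"
    by (simp add: compose3_lin lin_def matrix_vector_mult_def)
  then show "eval3 ((\<chi> i. compose3 (lin L $ i) (lin M)) $ i) v = eval3 (vars $ i) v"
    by (simp add: matrix_vector_mul_assoc assms)
qed

lemma compose3_lin_lin:
  assumes "L ** M = mat 1"
  shows "compose3 (compose3 p (lin L)) (lin M) = p"
  by (simp add: compose3_compose3 lin_comp[OF assms])

lemma homogeneous_lin: "homogeneous 1 (lin L $ i)"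
  by (auto simp: lin_def intro!: homogeneous_sum homogeneous_mult[of 0 _ 1] homogeneous_const homogeneous_vars)

lemma partial_lin: "partial j (lin L $ i) = const3 (L $ i $ j)"
  using exhaust_3[of j] by (auto simp: lin_def sum_3 partial_vars)

lemma pullback_form_vars: "pullback_form vars \<omega> = \<omega>"
proof (rule vec_eq_iff[THEN iffD2], intro allI)
  fix i :: 3
  show "pullback_form vars \<omega> $ i = \<omega> $ i"
    using exhaust_3[of i] by (auto simp: pullback_form_def partial_vars sum_3)
qed

text \<open>
  The chain rule; for a linear outer map its partial derivatives are constants and no
  derivative of a composite has to be computed.
\<close>

lemma pullback_form_lin:
  "pullback_form (\<chi> i. compose3 (lin L $ i) \<phi>) \<omega> = pullback_form \<phi> (pullback_form (lin L) \<omega>)"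
  by (simp add: pullback_form_def vec_eq_iff partial_lin compose3_lin compose3_compose3 partial_sum
      sum_3 algebra_simps)

text \<open>
  Common factors are excluded by pulling back along the inverse: this carries a common factor of
  the new coefficients to a common factor of the old ones.
\<close>

lemma foliation_form_pullback_lin:
  assumes "foliation_form d \<omega>" "L ** M = mat 1" "M ** L = mat 1"
  shows "foliation_form d (pullback_form (lin L) \<omega>)"
proof -
  let ?\<eta> = "pullback_form (lin L) \<omega>"
  have \<omega>: "homogeneous (d + 1) (\<omega> $ i)" "no_common_factor \<omega>" "(\<Sum>i\<in>UNIV. \<omega> $ i * vars $ i) = 0" for i
    using assms(1) by (auto simp: foliation_form_def)
  have "homogeneous (d + 1) (?\<eta> $ i)" for i
    using homogeneous_compose3[OF \<omega>(1) homogeneous_lin]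
    by (auto simp: pullback_form_def partial_lin intro!: homogeneous_sum homogeneous_mult[of "d + 1" _ 0]
        homogeneous_const)
  moreover have "(\<Sum>i\<in>UNIV. ?\<eta> $ i * vars $ i) = 0"
  proof -
    have "compose3 (\<Sum>i\<in>UNIV. \<omega> $ i * vars $ i) (lin L) = (\<Sum>i\<in>UNIV. ?\<eta> $ i * vars $ i)"
      by (simp add: pullback_form_def partial_lin sum_3) (simp add: lin_def sum_3 algebra_simps)
    then show ?thesis by (simp add: \<omega>)
  qed
  moreover have "no_common_factor ?\<eta>"
    unfolding no_common_factor_def
  proof (intro allI impI)
    fix g assume g: "\<forall>i. g dvd ?\<eta> $ i"
    have "\<omega> = pullback_form (lin M) ?\<eta>"
      by (simp add: pullback_form_lin[symmetric] lin_comp[OF assms(2)] pullback_form_vars)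
    moreover have "compose3 g (lin M) dvd pullback_form (lin M) ?\<eta> $ j" for j
      using g by (auto simp: pullback_form_def[of "lin M"] intro!: dvd_sum dvd_mult2 compose3_dvd)
    ultimately have "\<forall>j. compose3 g (lin M) dvd \<omega> $ j" by simp
    then obtain c where "compose3 g (lin M) = const3 c"
      using \<omega>(2) by (auto simp: no_common_factor_def)
    then have "compose3 (compose3 g (lin M)) (lin L) = const3 c" by simp
    then show "\<exists>c. g = const3 c" by (auto simp: compose3_lin_lin[OF assms(3)])
  qed
  ultimately show ?thesis by (simp add: foliation_form_def)
qed

lemma rational_map_lin_compose:
  assumes "rational_map \<phi>" "M ** L = mat 1"
  shows "rational_map (\<chi> i. compose3 (lin L $ i) \<phi>)"
proof -
  obtain n where n: "\<And>i. homogeneous n (\<phi> $ i)" and ncf: "no_common_factor \<phi>"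
    using assms by (auto simp: rational_map_def)
  have "homogeneous n (compose3 (lin L $ i) \<phi>)" for i
    using homogeneous_compose3[OF homogeneous_lin n] by simp
  moreover have "no_common_factor (\<chi> i. compose3 (lin L $ i) \<phi>)"
    unfolding no_common_factor_def
  proof (intro allI impI)
    fix g assume g: "\<forall>i. g dvd (\<chi> i. compose3 (lin L $ i) \<phi>) $ i"
    have "g dvd \<phi> $ j" for j
    proof -
      have "\<phi> $ j = compose3 ((\<chi> i. compose3 (lin M $ i) (lin L)) $ j) \<phi>"
        unfolding lin_comp[OF assms(2)] by simp
      also have "\<dots> = compose3 (lin M $ j) (\<chi> i. compose3 (lin L $ i) \<phi>)"
        by (simp add: compose3_compose3)
      finally show ?thesis
        using g by (auto simp: compose3_lin[of M] intro!: dvd_sum dvd_mult)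
    qed
    then show "\<exists>c. g = const3 c" using ncf by (auto simp: no_common_factor_def)
  qed
  ultimately show ?thesis by (auto simp: rational_map_def)
qed

lemma rational_map_compose_lin:
  assumes "rational_map \<psi>" "L ** M = mat 1" "M ** L = mat 1"
  shows "rational_map (\<chi> i. compose3 (\<psi> $ i) (lin M))"
proof -
  obtain n where n: "\<And>i. homogeneous n (\<psi> $ i)" and ncf: "no_common_factor \<psi>"
    using assms by (auto simp: rational_map_def)
  have "homogeneous n (compose3 (\<psi> $ i) (lin M))" for i
    using homogeneous_compose3[OF n homogeneous_lin] by simp
  moreover have "no_common_factor (\<chi> i. compose3 (\<psi> $ i) (lin M))"
    unfolding no_common_factor_def
  proof (intro allI impI)
    fix g assume "\<forall>i. g dvd (\<chi> i. compose3 (\<psi> $ i) (lin M)) $ i"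
    then have "compose3 g (lin L) dvd compose3 (compose3 (\<psi> $ i) (lin M)) (lin L)" for i
      by (intro compose3_dvd) simp
    then obtain c where "compose3 g (lin L) = const3 c"
      using ncf by (auto simp: no_common_factor_def compose3_lin_lin[OF assms(3)])
    then have "compose3 (compose3 g (lin L)) (lin M) = const3 c" by simp
    then show "\<exists>c. g = const3 c" by (auto simp: compose3_lin_lin[OF assms(2)])
  qed
  ultimately show ?thesis by (auto simp: rational_map_def)
qed

lemma birational_lin_compose:
  assumes "birational \<phi>" "L ** M = mat 1" "M ** L = mat 1"
  shows "birational (\<chi> i. compose3 (lin L $ i) \<phi>)"
proof -
  obtain \<psi> r s where \<psi>: "rational_map \<psi>" "r \<noteq> 0" "s \<noteq> 0"
    "(\<chi> i. compose3 (\<phi> $ i) \<psi>) = r *s vars" "(\<chi> i. compose3 (\<psi> $ i) \<phi>) = s *s vars"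
    and \<phi>: "rational_map \<phi>"
    using assms(1) unfolding birational_def by blast
  let ?\<phi> = "\<chi> i. compose3 (lin L $ i) \<phi>" and ?\<psi> = "\<chi> i. compose3 (\<psi> $ i) (lin M)"
  have \<phi>\<psi>: "compose3 (\<phi> $ i) \<psi> = r * vars $ i" and \<psi>\<phi>: "compose3 (\<psi> $ i) \<phi> = s * vars $ i" for i
    using \<psi>(4,5)[THEN arg_cong, of "\<lambda>v. v $ i"] by simp_all
  have "compose3 (?\<phi> $ i) ?\<psi> = compose3 r (lin M) * vars $ i" for i
  proof -
    have "compose3 (?\<phi> $ i) ?\<psi> = (\<Sum>j\<in>UNIV. const3 (L $ i $ j) * compose3 (compose3 (\<phi> $ j) \<psi>) (lin M))"
      by (simp add: compose3_lin compose3_compose3)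
    also have "\<dots> = compose3 r (lin M) * compose3 (lin L $ i) (lin M)"
      by (simp add: \<phi>\<psi> compose3_lin sum_3 algebra_simps)
    also have "compose3 (lin L $ i) (lin M) = vars $ i"
      using lin_comp[OF assms(2), THEN arg_cong, of "\<lambda>v. v $ i"] by simp
    finally show ?thesis .
  qed
  moreover have "compose3 (?\<psi> $ i) ?\<phi> = s * vars $ i" for i
  proof -
    have "(\<chi> i. compose3 (lin M $ i) ?\<phi>) = \<phi>"
    proof (rule vec_eq_iff[THEN iffD2], intro allI)
      fix i
      have "(\<chi> i. compose3 (lin M $ i) ?\<phi>) $ i = compose3 ((\<chi> i. compose3 (lin M $ i) (lin L)) $ i) \<phi>"
        by (simp add: compose3_compose3)
      then show "(\<chi> i. compose3 (lin M $ i) ?\<phi>) $ i = \<phi> $ i"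
        by (simp only: lin_comp[OF assms(3)] compose3_vars)
    qed
    then show ?thesis by (simp add: compose3_compose3 \<psi>\<phi>)
  qed
  moreover have "compose3 r (lin M) \<noteq> 0"
  proof
    assume "compose3 r (lin M) = 0"
    then have "compose3 (compose3 r (lin M)) (lin L) = 0" by simp
    then show False using \<psi>(2) by (simp add: compose3_lin_lin[OF assms(3)])
  qed
  ultimately show ?thesis
    unfolding birational_def
    using rational_map_lin_compose[OF \<phi> assms(3)] rational_map_compose_lin[OF \<psi>(1) assms(2,3)] \<psi>(3)
    by (intro conjI exI[of _ ?\<psi>] exI[of _ "compose3 r (lin M)"] exI[of _ s])
      (auto simp: vec_eq_iff)
qed

lemma unital_hom_poly: "unital_hom (\<lambda>p. poly p \<mu>)"
  by (simp add: unital_hom_def)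

lemma poly_insert3_poly: "poly (insert3 (\<lambda>c. [:c:]) w p) \<mu> = eval3 p (\<chi> i. poly (w $ i) \<mu>)"
  unfolding eval3_def
  by (rule unital_hom_unique[OF unital_hom_comp[OF unital_hom_poly unital_hom_insert3[OF unital_hom_const]]])
    (simp_all add: insert3_const3[OF unital_hom_const] insert3_vars[OF unital_hom_const])

lemma foliation_form_ne_0:
  assumes "foliation_form d \<omega>"
  obtains j where "\<omega> $ j \<noteq> 0"
proof (rule ccontr)
  assume "\<not> thesis"
  then have "\<omega> $ j = 0" for j using that by blast
  then obtain c where "vars $ 1 = const3 c"
    using assms by (fastforce simp: foliation_form_def no_common_factor_def)
  then have "eval3 (vars $ 1) (axis 1 x) = c" for x by simp
  from this[of 0] this[of 1] show False by simp
qed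

lemma det_neq_0_imp_inverse:
  fixes L :: "complex ^ 3 ^ 3"
  assumes "det L \<noteq> 0"
  obtains M where "L ** M = mat 1" "M ** L = mat 1"
  using assms invertible_det_nz[of L] by (auto simp: invertible_def)

text \<open>
  The position of the line at infinity and of the pencil of fibres: the point \<open>(0 : 0 : 1)\<close> is regular
  for the foliation, and the line \<open>x = 0\<close> through it is not tangent to the foliation there.

  To reach it, choose \<open>v\<close> with \<open>\<omega>\<^sub>j(v) \<noteq> 0\<close> for some \<open>j\<close> and with all coordinates nonzero, and let the last
  two columns of the matrix be \<open>e\<^sub>j\<close> and \<open>v\<close>. The coefficient of \<open>dy\<close> at \<open>(0, 0, 1)\<close> becomes \<open>\<omega>(v)(e\<^sub>j) = \<omega>\<^sub>j(v)\<close>,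
  and because no coordinate of \<open>v\<close> vanishes a third basis vector completes the frame.
\<close>

lemma generic_frame:
  assumes "foliation_form d \<omega>"
  obtains L M :: "complex ^ 3 ^ 3" where "L ** M = mat 1" "M ** L = mat 1"
    "eval3 (pullback_form (lin L) \<omega> $ 2) (vector [0, 0, 1]) \<noteq> 0"
proof -
  obtain j where "\<omega> $ j \<noteq> 0" using foliation_form_ne_0[OF assms] .
  moreover have "vars $ i \<noteq> 0" for i
    using exhaust_3[of i] by (auto simp: vars_simps)
  ultimately have "\<omega> $ j * vars $ 1 * vars $ 2 * vars $ 3 \<noteq> 0" by simp
  then obtain v where "eval3 (\<omega> $ j * vars $ 1 * vars $ 2 * vars $ 3) v \<noteq> 0"
    using eval3_eq_0_imp by blast
  then have v: "eval3 (\<omega> $ j) v \<noteq> 0" "v $ 1 \<noteq> 0" "v $ 2 \<noteq> 0" "v $ 3 \<noteq> 0" by auto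
  define l :: 3 where "l = (if j = 1 then 2 else 1)"
  define L :: "complex ^ 3 ^ 3" where "L = (\<chi> i. vector [axis l 1 $ i, axis j 1 $ i, v $ i])"
  have "det L \<noteq> 0"
    using exhaust_3[of j] v by (auto simp: det_3 L_def l_def axis_def)
  then obtain M where "L ** M = mat 1" "M ** L = mat 1"
    using det_neq_0_imp_inverse by blast
  moreover have "eval3 (pullback_form (lin L) \<omega> $ 2) (vector [0, 0, 1]) = eval3 (\<omega> $ j) v"
  proof -
    have "(\<chi> i. eval3 (lin L $ i) (vector [0, 0, 1])) = v"
      by (simp add: vec_eq_iff lin_def sum_3 L_def)
    then show ?thesis
      using exhaust_3[of j] by (auto simp: pullback_form_def partial_lin sum_3 L_def axis_def)
  qed
  ultimately show ?thesis using that v(1) by metis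
qed

section \<open>Singular points in the chart \<open>x \<noteq> 0\<close>\<close>

lemma prime_elem_vars_1: "prime_elem (vars $ 1)"
  by (simp add: vars_simps prime_elem_const_poly_iff prime_elem_linear_field_poly)

lemma coprime_vars_1:
  assumes "v $ 1 = 0" "eval3 p v \<noteq> 0"
  shows "coprime (vars $ 1) p"
proof (rule prime_elem_imp_coprime[OF prime_elem_vars_1])
  show "\<not> vars $ 1 dvd p" using assms by (auto elim!: dvdE)
qed

lemma is_unit_poly3_iff: "is_unit (g :: poly3) \<longleftrightarrow> (\<exists>c. c \<noteq> 0 \<and> g = const3 c)"
  by (auto simp: is_unit_poly_iff const3_def dvd_field_iff)

lemma euler_identity:
  assumes "foliation_form d \<omega>"
  shows "\<omega> $ 1 * vars $ 1 + \<omega> $ 2 * vars $ 2 + \<omega> $ 3 * vars $ 3 = 0"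
  using assms by (simp add: foliation_form_def sum_3)

text \<open>
  By the Euler identity a common factor of \<open>b\<close> and \<open>c\<close> divides \<open>x a\<close>. It is prime to \<open>x\<close>, since \<open>x\<close> does not
  divide \<open>b\<close>, and therefore it divides \<open>a\<close> as well.
\<close>

lemma coprime_last_coefficients:
  assumes \<omega>: "foliation_form d \<omega>" and v: "v $ 1 = 0" "eval3 (\<omega> $ 2) v \<noteq> 0"
  shows "coprime (\<omega> $ 2) (\<omega> $ 3)"
proof (rule coprimeI)
  fix g assume g: "g dvd \<omega> $ 2" "g dvd \<omega> $ 3"
  have "vars $ 1 * \<omega> $ 1 = - (\<omega> $ 2 * vars $ 2 + \<omega> $ 3 * vars $ 3)"
    using euler_identity[OF \<omega>] by (simp add: eq_neg_iff_add_eq_0 algebra_simps)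
  then have "g dvd vars $ 1 * \<omega> $ 1" using g by simp
  moreover have "coprime g (vars $ 1)"
    using coprime_divisors[OF g(1) dvd_refl, of "vars $ 1"] coprime_vars_1[OF v]
    by (simp add: coprime_commute)
  ultimately have "g dvd \<omega> $ 1" by (simp add: coprime_dvd_mult_right_iff)
  then have "\<forall>i. g dvd \<omega> $ i" using g by (simp add: forall_3)
  then obtain c where c: "g = const3 c"
    using \<omega> by (auto simp: foliation_form_def no_common_factor_def)
  moreover have "c \<noteq> 0" using c g(1) v(2) by auto
  ultimately show "is_unit g" by (auto simp: is_unit_poly3_iff)
qed

text \<open>
  The singular points in the chart \<open>x \<noteq> 0\<close> lie on finitely many fibres \<open>y = s x\<close>. Elimination gives
  a nonzero \<open>r(x, y)\<close> vanishing at every common zero of \<open>b\<close> and \<open>c\<close>. It might vanish identically on the line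
  \<open>x = 1\<close>, but not on all lines \<open>x = const\<close>; the cone of common zeros can be moved to a good one by scaling.
\<close>

lemma finite_singular_slopes:
  assumes \<omega>: "foliation_form d \<omega>" and v: "v $ 1 = 0" "eval3 (\<omega> $ 2) v \<noteq> 0"
  obtains S where "finite S"
    "\<And>w. w $ 1 \<noteq> 0 \<Longrightarrow> eval3 (\<omega> $ 2) w = 0 \<Longrightarrow> eval3 (\<omega> $ 3) w = 0 \<Longrightarrow> w $ 2 / w $ 1 \<in> S"
proof -
  have hom: "homogeneous (d + 1) (\<omega> $ i)" for i
    using \<omega> by (simp add: foliation_form_def)
  have "\<omega> $ 2 \<noteq> 0" using v(2) by auto
  then obtain a b r where r: "r \<noteq> 0" "a * \<omega> $ 2 + b * \<omega> $ 3 = [:r:]"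
    using ideal_meets_constants[OF coprime_last_coefficients[OF \<omega> v]] by blast
  obtain j where "coeff r j \<noteq> 0" using r(1) by (auto simp: poly_eq_iff)
  then obtain x where "poly ([:0, 1:] * coeff r j) x \<noteq> 0"
    using poly_all_0_iff_0[of "[:0, 1:] * coeff r j"] by auto
  then have x: "x \<noteq> 0" "poly (coeff r j) x \<noteq> 0" by auto
  define R where "R = map_poly (\<lambda>s. poly s x) r"
  have "coeff R j \<noteq> 0" using x by (simp add: R_def coeff_map_poly)
  then have "finite {y. poly R y = 0}" by (intro poly_roots_finite) auto
  then have fin: "finite ((\<lambda>y. y / x) ` {y. poly R y = 0})" by simp
  have "w $ 2 / w $ 1 \<in> (\<lambda>y. y / x) ` {y. poly R y = 0}"
    if w: "w $ 1 \<noteq> 0" "eval3 (\<omega> $ 2) w = 0" "eval3 (\<omega> $ 3) w = 0" for w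
  proof -
    define u where "u = (x / w $ 1) *s w"
    have "eval3 (a * \<omega> $ 2 + b * \<omega> $ 3) u = 0"
      using w by (simp add: u_def eval3_homogeneous[OF hom])
    then have "poly R (u $ 2) = 0"
      using w(1) unfolding r(2) by (simp add: eval3_def insert3_def map_poly_pCons R_def u_def)
    then show ?thesis
      using w(1) x(1) by (intro image_eqI[of _ _ "u $ 2"]) (simp_all add: u_def)
  qed
  then show ?thesis using that fin by blast
qed

text \<open>
  On each fibre \<open>y = s x\<close>, the polynomial \<open>p\<close> does not vanish at the point at infinity \<open>(0 : 0 : 1)\<close>, hence
  not at the nearby points \<open>(\<mu> : s \<mu> : 1)\<close> either, up to finitely many \<open>\<mu>\<close>. Take \<open>t = 1 / \<mu>\<close>.
\<close>

lemma generic_height: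
  assumes hom: "homogeneous n p" and p: "eval3 p (vector [0, 0, 1]) \<noteq> 0" and "finite S"
  obtains t where "\<And>s. s \<in> S \<Longrightarrow> eval3 p (vector [1, s, t]) \<noteq> 0"
proof -
  define f where "f s = insert3 (\<lambda>c. [:c:]) (vector [[:0, 1:], [:0, s:], 1]) p" for s
  have vec: "(\<chi> i. poly (vector [[:0, 1:], [:0, s:], 1] $ i) \<mu>) = (vector [\<mu>, \<mu> * s, 1] :: complex ^ 3)" for s \<mu>
    by (simp add: vec_eq_iff forall_3)
  have f: "poly (f s) \<mu> = eval3 p (vector [\<mu>, \<mu> * s, 1])" for s \<mu>
    by (simp add: f_def poly_insert3_poly vec)
  have "f s \<noteq> 0" for s
    using f[of s 0] p by auto
  then have "[:0, 1:] * (\<Prod>s\<in>S. f s) \<noteq> 0"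
    using \<open>finite S\<close> by simp
  then obtain \<mu> where "poly ([:0, 1:] * (\<Prod>s\<in>S. f s)) \<mu> \<noteq> 0"
    using poly_all_0_iff_0 by blast
  then have \<mu>: "\<mu> \<noteq> 0" "\<And>s. s \<in> S \<Longrightarrow> poly (f s) \<mu> \<noteq> 0"
    using \<open>finite S\<close> by (auto simp: poly_prod)
  have "eval3 p (vector [1, s, 1 / \<mu>]) \<noteq> 0" if "s \<in> S" for s
  proof -
    have "vector [\<mu>, \<mu> * s, 1] = \<mu> *s (vector [1, s, 1 / \<mu>] :: complex ^ 3)"
      using \<mu>(1) by (simp add: vec_eq_iff forall_3)
    then show ?thesis using \<mu>(2)[OF that] by (simp add: f eval3_homogeneous[OF hom])
  qed
  then show ?thesis using that by blast
qed

text \<open>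
  When a factor \<open>k\<close> of a form is known, the singular points of the reduced form are zeros of the
  quotient \<open>\<eta>'\<close>; the exact greatest common divisor is never needed.
\<close>

lemma reduce_form_factor:
  assumes "\<And>i. \<eta> $ i = k * \<eta>' $ i" "k \<noteq> 0"
  obtains g where "\<And>i. \<eta>' $ i = g * reduce_form \<eta> $ i"
proof -
  define h where "h = gcd (gcd (\<eta> $ 1) (\<eta> $ 2)) (\<eta> $ 3)"
  have "k dvd h" by (simp add: h_def assms(1))
  then obtain g where g: "h = k * g" ..
  have h: "h dvd \<eta> $ i" for i
    using exhaust_3[of i] by (auto simp: h_def intro: dvd_trans[OF gcd_dvd1])
  have "\<eta>' $ i = g * reduce_form \<eta> $ i" for i
  proof -
    have "h * reduce_form \<eta> $ i = \<eta> $ i"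
      using h[of i] by (simp add: reduce_form_def h_def[symmetric])
    then have "k * (g * reduce_form \<eta> $ i) = k * \<eta>' $ i" by (simp add: g assms(1) mult.assoc)
    then show ?thesis using assms(2) by simp
  qed
  then show ?thesis using that by blast
qed

section \<open>A de Jonquieres map\<close>

text \<open>
  The equation of the union of the fibres \<open>y = s x\<close> with \<open>s \<in> S\<close>, all of which the map below contracts.
\<close>

definition contracted :: "complex set \<Rightarrow> poly3" where
  "contracted S = (\<Prod>s\<in>S. vars $ 2 - const3 s * vars $ 1)"

text \<open>
  In the chart \<open>x = 1\<close> this is \<open>(y, z) \<mapsto> (y, h\<^sup>2 z + h\<^sup>4 + t)\<close> with \<open>h(y) = \<Prod>\<^bsub>s\<in>S\<^esub> (y - s)\<close>. The coefficient of \<open>z\<close> is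
  a square so that the derivative of the last coordinate in \<open>y\<close> vanishes on the contracted fibres. The exponents of \<open>x\<close>
  make the coordinates homogeneous when \<open>n + 1 = 2 |S|\<close> is the degree of \<open>h\<^sup>2\<close>. The term \<open>h\<^sup>4\<close> has the largest
  degree in the chart, so it alone survives on the line \<open>x = 0\<close>, which goes to \<open>(0 : 0 : 1)\<close>.
\<close>

definition dejonq :: "complex set \<Rightarrow> complex \<Rightarrow> nat \<Rightarrow> poly3 ^ 3" where
  "dejonq S t n = vector [vars $ 1 * vars $ 1 ^ (2 * n + 1), vars $ 2 * vars $ 1 ^ (2 * n + 1),
     (contracted S)\<^sup>2 * vars $ 3 * vars $ 1 ^ n + ((contracted S)\<^sup>2)\<^sup>2 + const3 t * vars $ 1 ^ (2 * n + 2)]"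

text \<open>
  In the chart, \<open>(y, z) \<mapsto> (y, (z - h\<^sup>4 - t) / h\<^sup>2)\<close>; the denominator appears in the first coordinate.
\<close>

definition dejonq_inv :: "complex set \<Rightarrow> complex \<Rightarrow> nat \<Rightarrow> poly3 ^ 3" where
  "dejonq_inv S t n = vector [vars $ 1 * ((contracted S)\<^sup>2 * vars $ 1 ^ n), vars $ 2 * ((contracted S)\<^sup>2 * vars $ 1 ^ n),
     vars $ 3 * vars $ 1 ^ (2 * n + 1) - ((contracted S)\<^sup>2)\<^sup>2 - const3 t * vars $ 1 ^ (2 * n + 2)]"

text \<open>
  The map and its inverse keep the slope \<open>y / x\<close>, so they only rescale this equation.
\<close>

lemma compose3_contracted:
  assumes "\<phi> $ 1 = vars $ 1 * u" "\<phi> $ 2 = vars $ 2 * u"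
  shows "compose3 (contracted S) \<phi> = u ^ card S * contracted S"
proof -
  have "compose3 (contracted S) \<phi> = (\<Prod>s\<in>S. u * (vars $ 2 - const3 s * vars $ 1))"
    by (simp add: contracted_def assms algebra_simps)
  then show ?thesis by (simp add: contracted_def prod.distrib)
qed

lemma homogeneous_contracted: "homogeneous (card S) (contracted S)"
  unfolding contracted_def
  by (intro homogeneous_prod homogeneous_diff homogeneous_vars
      homogeneous_mult[OF homogeneous_const homogeneous_vars]) simp

lemma eval3_contracted: "eval3 (contracted S) v = (\<Prod>s\<in>S. v $ 2 - s * v $ 1)"
  by (simp add: contracted_def)

lemma eval3_contracted_eq_0_iff:
  assumes "finite S" "v $ 1 \<noteq> 0"
  shows "eval3 (contracted S) v = 0 \<longleftrightarrow> v $ 2 / v $ 1 \<in> S"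
proof -
  have "v $ 2 - s * v $ 1 = 0 \<longleftrightarrow> v $ 2 / v $ 1 = s" for s
    using assms(2) by (auto simp: field_simps)
  then show ?thesis using assms(1) by (simp add: eval3_contracted)
qed

lemma eval3_contracted_infinity: "v $ 1 = 0 \<Longrightarrow> eval3 (contracted S) v = v $ 2 ^ card S"
  by (simp add: eval3_contracted)

lemma contracted_ne_0: "contracted S \<noteq> 0"
proof
  assume "contracted S = 0"
  then have "eval3 (contracted S) (vector [0, 1, 0]) = 0" by simp
  then show False by (simp add: eval3_contracted)
qed

text \<open>
  The test for common factors of both maps: some coordinate is, or leads to, a power of \<open>x\<close>, while
  another one does not vanish on the line \<open>x = 0\<close>.
\<close>

lemma const_if_dvd_power_vars_1:
  assumes "g dvd vars $ 1 ^ N" "g dvd p" "v $ 1 = 0" "eval3 p v \<noteq> 0"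
  shows "\<exists>c. g = const3 c"
proof -
  have "coprime (vars $ 1 ^ N) p" using coprime_vars_1[OF assms(3,4)] by simp
  then have "is_unit g" using assms(1,2) by (meson coprime_common_divisor)
  then show ?thesis by (auto simp: is_unit_poly3_iff)
qed

context
  fixes S :: "complex set" and t :: complex and n :: nat
  assumes S: "2 * card S = n + 1" and n: "n \<ge> 1"
begin

lemma eval3_dejonq_infinity:
  assumes "v $ 1 = 0"
  shows "eval3 (dejonq S t n $ 3) v = v $ 2 ^ (2 * n + 2)"
proof -
  have "eval3 (dejonq S t n $ 3) v = ((v $ 2 ^ card S) ^ 2) ^ 2"
    using n assms by (simp add: dejonq_def eval3_contracted_infinity power_0_left)
  also have "\<dots> = v $ 2 ^ (card S * 2 * 2)" by (simp only: power_mult)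
  also have "card S * 2 * 2 = 2 * n + 2" using S by simp
  finally show ?thesis .
qed

lemma rational_map_dejonq: "rational_map (dejonq S t n)"
proof -
  have X: "homogeneous N (vars $ 1 ^ N)" for N
    by (rule homogeneous_power[OF homogeneous_vars]) simp
  have G: "homogeneous (n + 1) ((contracted S)\<^sup>2)"
    by (rule homogeneous_power[OF homogeneous_contracted]) (use S in simp)
  have GG: "homogeneous (2 * n + 2) (((contracted S)\<^sup>2)\<^sup>2)"
    by (rule homogeneous_power[OF G]) simp
  have "homogeneous (2 * n + 2) (dejonq S t n $ i)" for i
  proof -
    have "homogeneous (2 * n + 2) (vars $ 1 * vars $ 1 ^ (2 * n + 1))"
      "homogeneous (2 * n + 2) (vars $ 2 * vars $ 1 ^ (2 * n + 1))"
      by (rule homogeneous_mult[OF homogeneous_vars X]; simp)+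
    moreover have "homogeneous (2 * n + 2) ((contracted S)\<^sup>2 * vars $ 3 * vars $ 1 ^ n +
        ((contracted S)\<^sup>2)\<^sup>2 + const3 t * vars $ 1 ^ (2 * n + 2))"
      by (intro homogeneous_add GG homogeneous_mult[OF homogeneous_mult[OF G homogeneous_vars refl] X]
          homogeneous_mult[OF homogeneous_const X]) simp_all
    ultimately show ?thesis using exhaust_3[of i] by (auto simp: dejonq_def)
  qed
  moreover have "no_common_factor (dejonq S t n)"
    unfolding no_common_factor_def
  proof (intro allI impI)
    fix g assume "\<forall>i. g dvd dejonq S t n $ i"
    then have "g dvd dejonq S t n $ 1" "g dvd dejonq S t n $ 3" by blast+
    then show "\<exists>c. g = const3 c"
      using const_if_dvd_power_vars_1[of g "2 * n + 2" "dejonq S t n $ 3" "vector [0, 1, 0]"]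
      by (simp add: eval3_dejonq_infinity) (simp add: dejonq_def)
  qed
  ultimately show ?thesis by (auto simp: rational_map_def)
qed

lemma rational_map_dejonq_inv: "rational_map (dejonq_inv S t n)"
proof -
  have X: "homogeneous N (vars $ 1 ^ N)" for N
    by (rule homogeneous_power[OF homogeneous_vars]) simp
  have G: "homogeneous (n + 1) ((contracted S)\<^sup>2)"
    by (rule homogeneous_power[OF homogeneous_contracted]) (use S in simp)
  have GG: "homogeneous (2 * n + 2) (((contracted S)\<^sup>2)\<^sup>2)"
    by (rule homogeneous_power[OF G]) simp
  have "homogeneous (2 * n + 2) (dejonq_inv S t n $ i)" for i
  proof -
    have "homogeneous (2 * n + 2) (vars $ j * ((contracted S)\<^sup>2 * vars $ 1 ^ n))" for j
      by (rule homogeneous_mult[OF homogeneous_vars homogeneous_mult[OF G X refl]]) simp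
    moreover have "homogeneous (2 * n + 2) (vars $ 3 * vars $ 1 ^ (2 * n + 1) -
        ((contracted S)\<^sup>2)\<^sup>2 - const3 t * vars $ 1 ^ (2 * n + 2))"
      by (intro homogeneous_diff GG homogeneous_mult[OF homogeneous_vars X]
          homogeneous_mult[OF homogeneous_const X]) simp_all
    ultimately show ?thesis using exhaust_3[of i] by (auto simp: dejonq_inv_def)
  qed
  moreover have "no_common_factor (dejonq_inv S t n)"
    unfolding no_common_factor_def
  proof (intro allI impI)
    fix g assume "\<forall>i. g dvd dejonq_inv S t n $ i"
    then have g: "g dvd dejonq_inv S t n $ 1" "g dvd dejonq_inv S t n $ 3" by blast+
    (* The first coordinate does not contain z, so neither does g; then g divides the coefficient
       of z in the third coordinate, which is a power of x. *)
    define x :: "complex poly poly" where "x = [:[:0, 1:]:]"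
    define a where "a = (\<Prod>s\<in>S. [:0, 1:] - [:[:s:]:] * x)"
    note const_hom = unital_hom_power[OF unital_hom_const, symmetric]
    have X: "vars $ 1 = [:x:]" by (simp add: vars_simps x_def)
    have a: "contracted S = [:a:]"
      unfolding a_def unital_hom_prod[OF unital_hom_const]
      by (simp add: contracted_def X vars_simps const3_def)
    have "dejonq_inv S t n $ 1 \<noteq> 0"
      using contracted_ne_0 by (simp add: dejonq_inv_def vars_simps)
    moreover have "degree (dejonq_inv S t n $ 1) = 0"
      by (simp add: dejonq_inv_def X a const_hom)
    ultimately have "degree g = 0" using dvd_imp_degree_le[OF g(1)] by simp
    then obtain g0 where g0: "g = [:g0:]" by (auto elim: degree_eq_zeroE)
    have "coeff (dejonq_inv S t n $ 3) 1 = x ^ (2 * n + 1)"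
      by (simp add: dejonq_inv_def X a const_hom const3_def) (simp add: vars_simps)
    then have "g0 dvd x ^ (2 * n + 1)"
      using g(2) unfolding g0 const_poly_dvd_iff by metis
    then have "g dvd vars $ 1 ^ (2 * n + 1)"
      by (simp only: g0 X const_hom const_poly_dvd_const_poly_iff)
    moreover have "eval3 (dejonq_inv S t n $ 3) (vector [0, 1, 0]) \<noteq> 0"
      by (simp add: dejonq_inv_def eval3_contracted)
    ultimately show "\<exists>c. g = const3 c"
      using const_if_dvd_power_vars_1[OF _ g(2), of "2 * n + 1" "vector [0, 1, 0]"] by simp
  qed
  ultimately show ?thesis by (auto simp: rational_map_def)
qed

lemma birational_dejonq: "birational (dejonq S t n)"
proof -
  define X where "X = vars $ 1"
  define Y where "Y = vars $ 2"
  define Z where "Z = vars $ 3"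
  define G where "G = (contracted S)\<^sup>2"
  define u where "u = G * X ^ n"
  define P where "P = X ^ (2 * n + 1)"
  note defs = X_def[symmetric] Y_def[symmetric] Z_def[symmetric] G_def[symmetric]
  let ?\<phi> = "dejonq S t n" and ?\<psi> = "dejonq_inv S t n"
  have \<phi>: "?\<phi> $ 1 = X * P" "?\<phi> $ 2 = Y * P" "?\<phi> $ 3 = G * Z * X ^ n + G\<^sup>2 + const3 t * X ^ (2 * n + 2)"
    by (simp_all add: dejonq_def defs P_def)
  have \<psi>: "?\<psi> $ 1 = X * u" "?\<psi> $ 2 = Y * u" "?\<psi> $ 3 = Z * P - G\<^sup>2 - const3 t * X ^ (2 * n + 2)"
    by (simp_all add: dejonq_inv_def defs u_def P_def)
  have G: "compose3 G \<phi> = w ^ (n + 1) * G" if "\<phi> $ 1 = X * w" "\<phi> $ 2 = Y * w" for \<phi> w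
    using compose3_contracted[of \<phi> w S] that S
    by (simp add: defs) (simp add: G_def power_mult_distrib power_mult[symmetric] mult.commute)
  have V: "compose3 X \<phi> = \<phi> $ 1" "compose3 Y \<phi> = \<phi> $ 2" "compose3 Z \<phi> = \<phi> $ 3" for \<phi>
    by (simp_all add: X_def Y_def Z_def)
  have "G \<noteq> 0" "X \<noteq> 0"
    using contracted_ne_0 by (simp_all add: G_def X_def vars_simps)
  have scale: "(w ^ (n + 1) * G)\<^sup>2 = w ^ (2 * n + 2) * G\<^sup>2" "(X * w) ^ (2 * n + 2) = w ^ (2 * n + 2) * X ^ (2 * n + 2)"
    "w ^ (n + 1) * G * W * (X * w) ^ n = w ^ (2 * n + 1) * (G * X ^ n) * W" for w W
  proof -
    have "(w ^ (n + 1))\<^sup>2 = w ^ ((n + 1) * 2)" by (simp only: power_mult)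
    also have "(n + 1) * 2 = 2 * n + 2" by simp
    finally show "(w ^ (n + 1) * G)\<^sup>2 = w ^ (2 * n + 2) * G\<^sup>2" by (simp only: power_mult_distrib)
    show "(X * w) ^ (2 * n + 2) = w ^ (2 * n + 2) * X ^ (2 * n + 2)"
      by (simp only: power_mult_distrib mult.commute)
    show "w ^ (n + 1) * G * W * (X * w) ^ n = w ^ (2 * n + 1) * (G * X ^ n) * W"
      by (simp add: power_mult_distrib mult_2 mult_2_right power_add mult_ac)
  qed
  have "compose3 (?\<phi> $ i) ?\<psi> = u ^ (2 * n + 2) * P * vars $ i" for i
  proof -
    (* The first two coordinates scale by u, hence G by u ^ (n + 1), and u ^ (2 * n + 2) comes
       out of all three coordinates of the composite. *)
    have "compose3 (?\<phi> $ 1) ?\<psi> = u ^ (2 * n + 2) * P * X"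
      by (simp add: \<phi> V \<psi>) (simp add: P_def V \<psi> power_mult_distrib algebra_simps)
    moreover have "compose3 (?\<phi> $ 2) ?\<psi> = u ^ (2 * n + 2) * P * Y"
      by (simp add: \<phi> V \<psi>) (simp add: P_def V \<psi> power_mult_distrib algebra_simps)
    moreover have "compose3 (?\<phi> $ 3) ?\<psi> = u ^ (2 * n + 2) * P * Z"
    proof -
      have "compose3 (?\<phi> $ 3) ?\<psi> = u ^ (n + 1) * G * ?\<psi> $ 3 * (X * u) ^ n + (u ^ (n + 1) * G)\<^sup>2
          + const3 t * (X * u) ^ (2 * n + 2)"
        unfolding \<phi>(3) by (simp only: compose3_hom compose3_const3 G[OF \<psi>(1,2)] V \<psi>(1,2))
      also have "\<dots> = u ^ (2 * n + 1) * u * (?\<psi> $ 3 + G\<^sup>2 + const3 t * X ^ (2 * n + 2))"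
        unfolding scale u_def[symmetric] by (simp add: algebra_simps)
      finally have "compose3 (?\<phi> $ 3) ?\<psi> = u ^ (2 * n + 1) * u * (?\<psi> $ 3 + G\<^sup>2 + const3 t * X ^ (2 * n + 2))" .
      then show ?thesis by (simp add: \<psi>(3) algebra_simps)
    qed
    ultimately show ?thesis using exhaust_3[of i] by (auto simp: defs)
  qed
  moreover have "compose3 (?\<psi> $ i) ?\<phi> = P ^ (2 * n + 2) * u * vars $ i" for i
  proof -
    have u: "compose3 u ?\<phi> = P ^ (2 * n + 1) * u"
      by (simp add: u_def G[OF \<phi>(1,2)] V \<phi>(1) power_mult_distrib mult_2 mult_2_right power_add algebra_simps)
    have "compose3 (?\<psi> $ 1) ?\<phi> = P ^ (2 * n + 2) * u * X" "compose3 (?\<psi> $ 2) ?\<phi> = P ^ (2 * n + 2) * u * Y"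
      by (simp_all add: \<psi> u V \<phi> algebra_simps)
    moreover have "compose3 (?\<psi> $ 3) ?\<phi> = P ^ (2 * n + 2) * u * Z"
    proof -
      have P: "compose3 P ?\<phi> = P ^ (2 * n + 2)"
        by (simp add: P_def V \<phi>(1) power_mult_distrib)
      have "compose3 (?\<psi> $ 3) ?\<phi> = ?\<phi> $ 3 * P ^ (2 * n + 2) - (P ^ (n + 1) * G)\<^sup>2
          - const3 t * (X * P) ^ (2 * n + 2)"
        unfolding \<psi>(3) by (simp only: compose3_hom compose3_const3 G[OF \<phi>(1,2)] V P \<phi>(1,2))
      also have "\<dots> = P ^ (2 * n + 2) * (?\<phi> $ 3 - G\<^sup>2 - const3 t * X ^ (2 * n + 2))"
        unfolding scale by (simp add: algebra_simps)
      finally have "compose3 (?\<psi> $ 3) ?\<phi> = P ^ (2 * n + 2) * (?\<phi> $ 3 - G\<^sup>2 - const3 t * X ^ (2 * n + 2))" .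
      then show ?thesis by (simp add: \<phi>(3) u_def algebra_simps)
    qed
    ultimately show ?thesis using exhaust_3[of i] by (auto simp: defs)
  qed
  moreover have "u ^ (2 * n + 2) * P \<noteq> 0" "P ^ (2 * n + 2) * u \<noteq> 0"
    using \<open>G \<noteq> 0\<close> \<open>X \<noteq> 0\<close> by (simp_all add: u_def P_def)
  ultimately show ?thesis
    unfolding birational_def
    using rational_map_dejonq rational_map_dejonq_inv
    by (intro conjI exI[of _ ?\<psi>] exI[of _ "u ^ (2 * n + 2) * P"] exI[of _ "P ^ (2 * n + 2) * u"])
      (auto simp: vec_eq_iff)
qed

end

section \<open>The pulled-back foliation\<close>

lemma partial_contracted_3: "partial 3 (contracted S) = 0"
proof -
  have "partial 3 (prod f A) = 0" if "\<And>x. partial 3 (f x) = 0" for f :: "complex \<Rightarrow> poly3" and A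
    by (induction A rule: infinite_finite_induct) (simp_all add: that)
  then show ?thesis unfolding contracted_def by this (simp add: partial_vars)
qed

context
  fixes S :: "complex set" and t :: complex and n d :: nat and \<omega> :: "poly3 ^ 3"
  assumes card: "2 * card S = n + 1" and n: "n \<ge> 1" and fin: "finite S"
    and \<omega>: "foliation_form d \<omega>"
    and vertical: "eval3 (\<omega> $ 2) (vector [0, 0, 1]) \<noteq> 0"
    and slopes: "\<And>w. w $ 1 \<noteq> 0 \<Longrightarrow> eval3 (\<omega> $ 2) w = 0 \<Longrightarrow> eval3 (\<omega> $ 3) w = 0 \<Longrightarrow> w $ 2 / w $ 1 \<in> S"
    and height: "\<And>s. s \<in> S \<Longrightarrow> eval3 (\<omega> $ 2) (vector [1, s, t]) \<noteq> 0"
begin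

lemma homogeneous_form: "homogeneous (d + 1) (\<omega> $ i)"
  using \<omega> by (simp add: foliation_form_def)

lemma partial_dejonq:
  "partial 1 (dejonq S t n $ 1) = of_nat (2 * n + 2) * vars $ 1 ^ (2 * n + 1)"
  "partial 2 (dejonq S t n $ 1) = 0" "partial 3 (dejonq S t n $ 1) = 0"
  "partial 1 (dejonq S t n $ 2) = of_nat (2 * n + 1) * vars $ 2 * vars $ 1 ^ (2 * n)"
  "partial 2 (dejonq S t n $ 2) = vars $ 1 ^ (2 * n + 1)" "partial 3 (dejonq S t n $ 2) = 0"
  "partial 3 (dejonq S t n $ 3) = (contracted S)\<^sup>2 * vars $ 1 ^ n"
proof -
  have power: "partial 1 (vars $ 1 ^ Suc k) = of_nat (Suc k) * vars $ 1 ^ k"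
    "partial 2 (vars $ 1 ^ k) = 0" "partial 3 (vars $ 1 ^ k) = 0" for k
    by (simp_all only: partial_power partial_vars) simp_all
  have coords: "dejonq S t n $ 1 = vars $ 1 ^ Suc (2 * n + 1)" "dejonq S t n $ 2 = vars $ 2 * vars $ 1 ^ Suc (2 * n)"
    by (simp_all add: dejonq_def)
  have deg: "Suc (2 * n + 1) = 2 * n + 2" "Suc (2 * n) = 2 * n + 1" by simp_all
  show "partial 1 (dejonq S t n $ 1) = of_nat (2 * n + 2) * vars $ 1 ^ (2 * n + 1)"
    unfolding coords power by (simp only: deg)
  show "partial 2 (dejonq S t n $ 1) = 0" "partial 3 (dejonq S t n $ 1) = 0"
    by (simp_all only: coords power)
  show "partial 1 (dejonq S t n $ 2) = of_nat (2 * n + 1) * vars $ 2 * vars $ 1 ^ (2 * n)"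
    "partial 2 (dejonq S t n $ 2) = vars $ 1 ^ (2 * n + 1)" "partial 3 (dejonq S t n $ 2) = 0"
    unfolding coords partial_mult power partial_vars by (simp_all add: mult_ac)
  show "partial 3 (dejonq S t n $ 3) = (contracted S)\<^sup>2 * vars $ 1 ^ n"
    by (simp add: dejonq_def partial_power partial_vars partial_contracted_3)
qed

text \<open>
  This is where the exponent 2 of the equation of the contracted fibres is used.
\<close>

lemma eval3_partial_2_dejonq:
  "eval3 (contracted S) v = 0 \<Longrightarrow> eval3 (partial 2 (dejonq S t n $ 3)) v = 0"
  by (simp add: dejonq_def partial_power partial_vars)

lemma pullback_dejonq:
  "pullback_form (dejonq S t n) \<omega> $ 1 =
     compose3 (\<omega> $ 1) (dejonq S t n) * (of_nat (2 * n + 2) * vars $ 1 ^ (2 * n + 1)) +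
     compose3 (\<omega> $ 2) (dejonq S t n) * (of_nat (2 * n + 1) * vars $ 2 * vars $ 1 ^ (2 * n)) +
     compose3 (\<omega> $ 3) (dejonq S t n) * partial 1 (dejonq S t n $ 3)"
  "pullback_form (dejonq S t n) \<omega> $ 2 =
     compose3 (\<omega> $ 2) (dejonq S t n) * vars $ 1 ^ (2 * n + 1) +
     compose3 (\<omega> $ 3) (dejonq S t n) * partial 2 (dejonq S t n $ 3)"
  "pullback_form (dejonq S t n) \<omega> $ 3 =
     compose3 (\<omega> $ 3) (dejonq S t n) * ((contracted S)\<^sup>2 * vars $ 1 ^ n)"
  by (simp_all only: pullback_form_def vec_lambda_beta sum_3 partial_dejonq mult_zero_right add_0_left add_0_right)

text \<open>
  Off the contracted fibres the map is a local isomorphism onto points whose slope is not in \<open>S\<close>,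
  and these are regular. A contracted fibre, of slope \<open>s\<close>, goes to the single point \<open>(1 : s : t)\<close>, and
  there the coefficient of \<open>dy\<close> in the pull-back is that of \<open>\<omega>\<close> at this point, up to a power of \<open>x\<close>, because
  the derivative in \<open>y\<close> of the last coordinate vanishes; \<open>t\<close> is chosen to make it nonzero.
\<close>

lemma regular_in_chart:
  assumes v: "v $ 1 \<noteq> 0"
  shows "\<exists>i. eval3 (pullback_form (dejonq S t n) \<omega> $ i) v \<noteq> 0"
proof (rule ccontr)
  assume "\<not> ?thesis"
  then have zero: "eval3 (pullback_form (dejonq S t n) \<omega> $ i) v = 0" for i by blast
  define w where "w = (\<chi> i. eval3 (dejonq S t n $ i) v)"
  have w: "w $ 1 = v $ 1 * v $ 1 ^ (2 * n + 1)" "w $ 2 = v $ 2 * v $ 1 ^ (2 * n + 1)"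
    by (simp_all add: w_def dejonq_def)
  have w1: "w $ 1 \<noteq> 0" and slope: "w $ 2 / w $ 1 = v $ 2 / v $ 1"
    using v by (simp_all add: w)
  have z2: "eval3 (\<omega> $ 2) w * v $ 1 ^ (2 * n + 1) +
      eval3 (\<omega> $ 3) w * eval3 (partial 2 (dejonq S t n $ 3)) v = 0"
    using zero[of 2] unfolding pullback_dejonq by (simp add: w_def)
  show False
  proof (cases "eval3 (contracted S) v = 0")
    case True
    then have "eval3 (\<omega> $ 2) w = 0"
      using z2 v by (simp add: eval3_partial_2_dejonq)
    moreover have "w = v $ 1 ^ (2 * n + 2) *s vector [1, v $ 2 / v $ 1, t]"
    proof -
      have "w $ 3 = t * v $ 1 ^ (2 * n + 2)" using True by (simp add: w_def dejonq_def)
      then show ?thesis using v by (simp add: vec_eq_iff forall_3 w)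
    qed
    moreover have "v $ 2 / v $ 1 \<in> S" using True eval3_contracted_eq_0_iff[OF fin v] by simp
    ultimately show False using height v by (simp add: eval3_homogeneous[OF homogeneous_form])
  next
    case False
    then have "eval3 (\<omega> $ 3) w = 0"
      using zero[of 3] v unfolding pullback_dejonq by (simp add: w_def)
    moreover from this have "eval3 (\<omega> $ 2) w = 0" using z2 v by simp
    ultimately have "v $ 2 / v $ 1 \<in> S" using slopes[OF w1] slope by simp
    then show False using False eval3_contracted_eq_0_iff[OF fin v] by simp
  qed
qed

text \<open>
  Composing the Euler identity \<open>a x + b y + c z = 0\<close> with the map, whose first two coordinates are
  divisible by \<open>x\<^bsup>2n+1\<^esup>\<close> while the third one is prime to \<open>x\<close>, shows how often \<open>x\<close> divides the composite of \<open>c\<close>.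
\<close>

lemma contact_at_infinity:
  obtains e where "compose3 (\<omega> $ 3) (dejonq S t n) = vars $ 1 ^ (2 * n + 1) * e"
proof -
  let ?\<phi> = "dejonq S t n"
  let ?X = "vars $ 1 ^ (2 * n + 1)"
  have "compose3 (\<omega> $ 1 * vars $ 1 + \<omega> $ 2 * vars $ 2 + \<omega> $ 3 * vars $ 3) ?\<phi> = 0"
    by (simp only: euler_identity[OF \<omega>] compose3_hom)
  then have "compose3 (\<omega> $ 3) ?\<phi> * ?\<phi> $ 3 =
      - (compose3 (\<omega> $ 1) ?\<phi> * ?\<phi> $ 1 + compose3 (\<omega> $ 2) ?\<phi> * ?\<phi> $ 2)"
    by (simp add: eq_neg_iff_add_eq_0 algebra_simps)
  moreover have "?X dvd ?\<phi> $ 1" "?X dvd ?\<phi> $ 2" by (simp_all add: dejonq_def del: power_Suc)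
  ultimately have "?X dvd compose3 (\<omega> $ 3) ?\<phi> * ?\<phi> $ 3" by (simp del: power_Suc)
  moreover have "coprime ?X (?\<phi> $ 3)"
    using coprime_vars_1[of "vector [0, 1, 0]" "?\<phi> $ 3"] eval3_dejonq_infinity[OF card n, of "vector [0, 1, 0]" t]
    by simp
  ultimately have "?X dvd compose3 (\<omega> $ 3) ?\<phi>" by (simp add: coprime_dvd_mult_left_iff del: power_Suc)
  then show ?thesis using that by (auto elim: dvdE)
qed

text \<open>
  The pull-back is divisible by \<open>x\<^bsup>2n\<^esup>\<close>. In the quotient \<open>\<eta>'\<close> the coefficient of \<open>dx\<close> reduces on the line
  \<open>x = 0\<close> to \<open>(2n + 1) y (b \<circ> \<phi>)\<close>, and since \<open>\<phi>\<close> maps this line to \<open>(0 : 0 : 1)\<close>, where \<open>b \<noteq> 0\<close>, this is a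
  nonzero constant times a power of \<open>y\<close>. The chart \<open>x \<noteq> 0\<close> being regular, only \<open>x = y = 0\<close> remains.
\<close>

lemma zeros_of_reduced_pullback:
  assumes zero: "\<forall>i. eval3 (reduce_form (pullback_form (dejonq S t n) \<omega>) $ i) v = 0"
  shows "v $ 1 = 0 \<and> v $ 2 = 0"
proof -
  let ?\<phi> = "dejonq S t n" and ?\<eta> = "pullback_form (dejonq S t n) \<omega>"
  obtain e where e: "compose3 (\<omega> $ 3) ?\<phi> = vars $ 1 ^ (2 * n + 1) * e"
    using contact_at_infinity .
  define \<eta>' where "\<eta>' = (vector [
    compose3 (\<omega> $ 1) ?\<phi> * (of_nat (2 * n + 2) * vars $ 1) +
      compose3 (\<omega> $ 2) ?\<phi> * (of_nat (2 * n + 1) * vars $ 2) + vars $ 1 * e * partial 1 (?\<phi> $ 3),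
    compose3 (\<omega> $ 2) ?\<phi> * vars $ 1 + vars $ 1 * e * partial 2 (?\<phi> $ 3),
    vars $ 1 * e * ((contracted S)\<^sup>2 * vars $ 1 ^ n)] :: poly3 ^ 3)"
  have "?\<eta> $ i = vars $ 1 ^ (2 * n) * \<eta>' $ i" for i
    using exhaust_3[of i] by (auto simp: pullback_dejonq \<eta>'_def e algebra_simps)
  moreover have "vars $ 1 ^ (2 * n) \<noteq> 0" by (simp add: vars_simps)
  ultimately obtain g where g: "\<And>i. \<eta>' $ i = g * reduce_form ?\<eta> $ i" and \<eta>: "\<And>i. ?\<eta> $ i = vars $ 1 ^ (2 * n) * \<eta>' $ i"
    using reduce_form_factor[of ?\<eta> "vars $ 1 ^ (2 * n)" \<eta>'] by metis
  have zero': "eval3 (\<eta>' $ i) v = 0" for i by (simp add: g zero)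
  have v1: "v $ 1 = 0" using regular_in_chart[of v] zero' by (auto simp: \<eta>)
  define w where "w = (\<chi> i. eval3 (?\<phi> $ i) v)"
  have "w = v $ 2 ^ (2 * n + 2) *s vector [0, 0, 1]"
    using v1 eval3_dejonq_infinity[OF card n v1, of t] by (simp add: w_def vec_eq_iff forall_3 dejonq_def)
  then have w: "eval3 (\<omega> $ 2) w = (v $ 2 ^ (2 * n + 2)) ^ (d + 1) * eval3 (\<omega> $ 2) (vector [0, 0, 1])"
    by (simp only: eval3_homogeneous[OF homogeneous_form])
  have "eval3 (\<eta>' $ 1) v = eval3 (\<omega> $ 2) w * (of_nat (2 * n + 1) * v $ 2)"
    by (simp add: \<eta>'_def v1 w_def del: of_nat_add of_nat_mult of_nat_Suc)
  then have "eval3 (\<omega> $ 2) w * (of_nat (2 * n + 1) * v $ 2) = 0" using zero' by simp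
  moreover have "(of_nat (2 * n + 1) :: complex) \<noteq> 0" by (simp only: of_nat_eq_0_iff)
  ultimately have "v $ 2 = 0" using vertical by (auto simp: w)
  then show ?thesis using v1 by simp
qed

end

lemma normalized_case:
  assumes \<omega>: "foliation_form d \<omega>" and vertical: "eval3 (\<omega> $ 2) (vector [0, 0, 1]) \<noteq> 0"
  shows "\<exists>\<phi>. birational \<phi> \<and>
    (\<forall>v. (\<forall>i. eval3 (reduce_form (pullback_form \<phi> \<omega>) $ i) v = 0) \<longrightarrow> v $ 1 = 0 \<and> v $ 2 = 0)"
proof -
  obtain T where T: "finite T"
    "\<And>w. w $ 1 \<noteq> 0 \<Longrightarrow> eval3 (\<omega> $ 2) w = 0 \<Longrightarrow> eval3 (\<omega> $ 3) w = 0 \<Longrightarrow> w $ 2 / w $ 1 \<in> T"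
    using finite_singular_slopes[OF \<omega> _ vertical] by auto
  (* The extra slope 0 makes S nonempty; otherwise n would not be positive. *)
  define S where "S = insert 0 T"
  have S: "finite S" "card S \<ge> 1" using T(1) by (auto simp: S_def Suc_le_eq card_gt_0_iff)
  have hom: "homogeneous (d + 1) (\<omega> $ 2)" using \<omega> by (simp add: foliation_form_def)
  obtain t where t: "\<And>s. s \<in> S \<Longrightarrow> eval3 (\<omega> $ 2) (vector [1, s, t]) \<noteq> 0"
    using generic_height[OF hom vertical S(1)] by blast
  define n where "n = 2 * card S - 1"
  have n: "2 * card S = n + 1" "n \<ge> 1" using S(2) by (simp_all add: n_def)
  have slopes: "w $ 2 / w $ 1 \<in> S" if "w $ 1 \<noteq> 0" "eval3 (\<omega> $ 2) w = 0" "eval3 (\<omega> $ 3) w = 0" for w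
    using T(2)[OF that] by (simp add: S_def)
  show ?thesis
    using birational_dejonq[OF n] zeros_of_reduced_pullback[OF n S(1) \<omega> vertical slopes t] by blast
qed

theorem theorem1:
  fixes \<F> :: "(poly3 ^ 3) set" and d :: nat
  assumes "foliation d \<F>"
  shows "\<exists>\<phi>. birational \<phi> \<and>
    (\<forall>P\<in>Sing (pullback \<phi> \<F>). \<forall>Q\<in>Sing (pullback \<phi> \<F>). P = Q)"
proof -
  obtain \<omega> where \<omega>: "foliation_form d \<omega>" and \<F>: "\<F> = form_class \<omega>"
    using assms by (auto simp: foliation_def)
  obtain L M where LM: "L ** M = mat 1" "M ** L = mat 1"
    and vertical: "eval3 (pullback_form (lin L) \<omega> $ 2) (vector [0, 0, 1]) \<noteq> 0"
    using generic_frame[OF \<omega>] .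
  obtain \<phi> where \<phi>: "birational \<phi>" and zeros:
    "\<forall>v. (\<forall>i. eval3 (reduce_form (pullback_form \<phi> (pullback_form (lin L) \<omega>)) $ i) v = 0)
      \<longrightarrow> v $ 1 = 0 \<and> v $ 2 = 0"
    using normalized_case[OF foliation_form_pullback_lin[OF \<omega> LM] vertical] by (elim exE conjE)
  define \<Phi> where "\<Phi> = (\<chi> i. compose3 (lin L $ i) \<phi>)"
  have "birational \<Phi>" unfolding \<Phi>_def by (rule birational_lin_compose[OF \<phi> LM])
  moreover have sing: "P = proj (vector [0, 0, 1])" if P: "P \<in> Sing (pullback \<Phi> \<F>)" for P
  proof -
    have "\<omega> \<in> \<F>" unfolding \<F> form_class_def by (auto intro!: exI[of _ 1])
    then have "reduce_form (pullback_form \<Phi> \<omega>) \<in> pullback \<Phi> \<F>" by (auto simp: pullback_def)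
    moreover obtain v where v: "P = proj v" "v \<noteq> 0"
      "\<forall>\<eta>\<in>pullback \<Phi> \<F>. \<forall>i. eval3 (\<eta> $ i) v = 0"
      using P unfolding Sing_def by blast
    ultimately have "\<forall>i. eval3 (reduce_form (pullback_form \<Phi> \<omega>) $ i) v = 0" by blast
    then have v12: "v $ 1 = 0 \<and> v $ 2 = 0"
      using zeros unfolding \<Phi>_def pullback_form_lin by blast
    then have v3: "v $ 3 \<noteq> 0" using v(2) by (auto simp: vec_eq_iff forall_3)
    have "proj v \<subseteq> proj (vector [0, 0, 1])"
    proof
      fix u assume "u \<in> proj v"
      then obtain c where "u = c *s v" "c \<noteq> 0" by (auto simp: proj_def)
      then have "u = (c * v $ 3) *s vector [0, 0, 1]" "c * v $ 3 \<noteq> 0"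
        using v12 v3 by (auto simp: vec_eq_iff forall_3)
      then show "u \<in> proj (vector [0, 0, 1])" unfolding proj_def by blast
    qed
    moreover have "proj (vector [0, 0, 1]) \<subseteq> proj v"
    proof
      fix u assume "u \<in> proj (vector [0, 0, 1])"
      then obtain c where "u = c *s vector [0, 0, 1]" "c \<noteq> 0" by (auto simp: proj_def)
      then have "u = (c / v $ 3) *s v" "c / v $ 3 \<noteq> 0"
        using v12 v3 by (auto simp: vec_eq_iff forall_3)
      then show "u \<in> proj v" unfolding proj_def by blast
    qed
    ultimately show ?thesis using v(1) by simp
  qed
  ultimately show ?thesis by (intro exI[of _ \<Phi>]) blast
qed

end
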